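(* Let $n\ge 6$ be an integer and let $\Delta_n$ be the graph defined in the context. Then the independent location number (independent metric dimension) of $\Delta_n$ is $3$, i.e. the minimum cardinality of a resolving set of $\Delta_n$ that is an independent set of vertices equals $3$.
   Context: All indices are taken modulo $n$. The heptagonal circular ladder $\Gamma_n$ is the graph with vertex set $\{p_t,q_t,r_t,s_t : 1\le t\le n\}$ and edge set $\{p_tp_{t+1},\ p_tq_t,\ q_tr_t,\ r_ts_t,\ s_tr_{t+1} : 1\le t\le n\}$. The graph $\Delta_n$ has the same vertex set as $\Gamma_n$ and edge set $E(\Gamma_n)\cup\{r_tq_{t+1}:1\le t\le n\}$. For a connected graph $G$ with distance $d$, a set $Y\subseteq V(G)$ is a resolving set if for every two distinct vertices $u,v$ there is $y\in Y$ with $d(y,u)\ne d(y,v)$. An independent resolving set is a resolving set no two of whose vertices are adjacent; the independent location number is the minimum cardinality of an independent resolving set. *)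

theory Defs
  imports "Graph_Theory.Graph_Theory"
begin

text \<open>
  A simple graph is a symmetric loop-free finite digraph (locale \<open>pair_graph\<close>); an edge \<open>uv\<close> is
  the pair of arcs \<open>(u, v)\<close>, \<open>(v, u)\<close>.
\<close>

context pair_graph
begin

text \<open>
  With unit arc costs, \<open>\<mu>\<close> is the least length of a walk from \<open>u\<close> to \<open>v\<close>
  (\<open>\<infinity>\<close> if there is none).
\<close>

definition gdist :: "'a \<Rightarrow> 'a \<Rightarrow> ereal" where
  "gdist u v = \<mu> (\<lambda>_. 1) u v"

definition resolving_set :: "'a set \<Rightarrow> bool" where
  "resolving_set Y \<longleftrightarrow> Y \<subseteq> pverts G \<and>
     (\<forall>u \<in> pverts G. \<forall>v \<in> pverts G. u \<noteq> v \<longrightarrow> (\<exists>y \<in> Y. gdist y u \<noteq> gdist y v))"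

definition independent_resolving_set :: "'a set \<Rightarrow> bool" where
  "independent_resolving_set Y \<longleftrightarrow> resolving_set Y \<and> (\<forall>u \<in> Y. \<forall>v \<in> Y. (u, v) \<notin> parcs G)"

text \<open>
  Some graphs (such as complete graphs on at least three vertices) have no independent resolving
  set; the value is then unspecified.
\<close>

definition independent_location_number :: nat where
  "independent_location_number = (LEAST k. \<exists>Y. independent_resolving_set Y \<and> card Y = k)"

end

datatype vertex = P nat | Q nat | R nat | S nat

text \<open>The index \<open>t + 1\<close> modulo \<open>n\<close>, with representatives \<open>1, \<dots>, n\<close>.\<close>

definition nxt :: "nat \<Rightarrow> nat \<Rightarrow> nat" where
  "nxt n t = t mod n + 1"

definition ladder_vertices :: "nat \<Rightarrow> vertex set" where
  "ladder_vertices n = (\<Union>t \<in> {1..n}. {P t, Q t, R t, S t})"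

text \<open>Each edge is listed in one orientation only.\<close>

definition Gamma_edges :: "nat \<Rightarrow> vertex rel" where
  "Gamma_edges n = (\<Union>t \<in> {1..n}.
     {(P t, P (nxt n t)), (P t, Q t), (Q t, R t), (R t, S t), (S t, R (nxt n t))})"

definition Delta_edges :: "nat \<Rightarrow> vertex rel" where
  "Delta_edges n = Gamma_edges n \<union> (\<Union>t \<in> {1..n}. {(R t, Q (nxt n t))})"

definition Delta :: "nat \<Rightarrow> vertex pair_pre_digraph" where
  "Delta n = \<lparr>pverts = ladder_vertices n, parcs = Delta_edges n \<union> (Delta_edges n)\<inverse>\<rparr>"

lemma nxt_less: "t < n \<Longrightarrow> nxt n t = Suc t"
  by (simp add: nxt_def)

lemma nxt_self: "nxt n n = 1"
  by (simp add: nxt_def)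

lemma nxt_in: "1 \<le> t \<Longrightarrow> t \<le> n \<Longrightarrow> nxt n t \<in> {1..n}"
  by (cases "t = n") (auto simp: nxt_less nxt_self)

lemma nxt_neq: "2 \<le> n \<Longrightarrow> 1 \<le> t \<Longrightarrow> t \<le> n \<Longrightarrow> nxt n t \<noteq> t"
  by (cases "t = n") (auto simp: nxt_less nxt_self)

lemma Delta_edges_ends:
  assumes "2 \<le> n" "(u, v) \<in> Delta_edges n"
  shows "u \<in> ladder_vertices n \<and> v \<in> ladder_vertices n \<and> u \<noteq> v"
  using assms nxt_in[of _ n] nxt_neq[of n]
  by (fastforce simp: Delta_edges_def Gamma_edges_def ladder_vertices_def)

lemma pair_graph_Delta:
  assumes "2 \<le> n"
  shows "pair_graph (Delta n)"
proof
  show "finite (pverts (Delta n))"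
    by (simp add: Delta_def ladder_vertices_def)
  show "finite (parcs (Delta n))"
    by (simp add: Delta_def Delta_edges_def Gamma_edges_def)
  show "symmetric (Delta n)"
    by (auto simp: symmetric_def Delta_def sym_def)
qed (use Delta_edges_ends[OF assms] in \<open>fastforce simp: Delta_def\<close>)+

lemma connected_Delta:
  assumes "2 \<le> n"
  shows "connected (Delta n)"
proof -
  interpret pair_graph "Delta n"
    using assms by (rule pair_graph_Delta)
  have P1: "P 1 \<in> pverts (Delta n)"
    using assms by (auto simp: Delta_def ladder_vertices_def)
  have P: "P 1 \<rightarrow>\<^sup>*\<^bsub>Delta n\<^esub> P t" if "1 \<le> t" "t \<le> n" for t
    using that
  proof (induction t rule: dec_induct)
    case base
    then show ?case using P1 by simp
  next
    case (step t)
    then have "(P t, P (Suc t)) \<in> parcs (Delta n)"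
      using nxt_less[of t n] by (fastforce simp: Delta_def Delta_edges_def Gamma_edges_def)
    then show ?case using step by (auto intro: reachable_adj_trans)
  qed
  have Q: "P 1 \<rightarrow>\<^sup>*\<^bsub>Delta n\<^esub> Q t" if "1 \<le> t" "t \<le> n" for t
  proof -
    have "(P t, Q t) \<in> parcs (Delta n)"
      using that by (auto simp: Delta_def Delta_edges_def Gamma_edges_def)
    then show ?thesis using P[OF that] by (auto intro: reachable_adj_trans)
  qed
  have R: "P 1 \<rightarrow>\<^sup>*\<^bsub>Delta n\<^esub> R t" if "1 \<le> t" "t \<le> n" for t
  proof -
    have "(Q t, R t) \<in> parcs (Delta n)"
      using that by (auto simp: Delta_def Delta_edges_def Gamma_edges_def)
    then show ?thesis using Q[OF that] by (auto intro: reachable_adj_trans)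
  qed
  have S: "P 1 \<rightarrow>\<^sup>*\<^bsub>Delta n\<^esub> S t" if "1 \<le> t" "t \<le> n" for t
  proof -
    have "(R t, S t) \<in> parcs (Delta n)"
      using that by (auto simp: Delta_def Delta_edges_def Gamma_edges_def)
    then show ?thesis using R[OF that] by (auto intro: reachable_adj_trans)
  qed
  have *: "P 1 \<rightarrow>\<^sup>*\<^bsub>Delta n\<^esub> v" if "v \<in> pverts (Delta n)" for v
    using that P Q R S by (auto simp: Delta_def ladder_vertices_def)
  have "u \<rightarrow>\<^sup>*\<^bsub>Delta n\<^esub> v" if "u \<in> pverts (Delta n)" "v \<in> pverts (Delta n)" for u v
    using *[OF that(1)] *[OF that(2)] symmetric_reachable[OF sym_arcs] reachable_trans by blast
  then have "strongly_connected (Delta n)"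
    using P1 by (auto simp: strongly_connected_def)
  then show ?thesis
    by (auto simp: connected_def strongly_connected_def intro: reachable_mk_symmetricI)
qed

end

(* If {a, b} resolves a graph, the distances from b to the vertices at distance k from a are
   pairwise distinct and lie within k of the distance from b to a, so there are at most 2k + 1
   such vertices. Every R has four neighbours, and every P and Q has at least six vertices at
   distance two, so a and b would both be S vertices; a closer look at the five vertices at
   distance two from an S vertex rules this out as well. On the other hand, the distances from
   three suitable vertices of the P cycle determine both the index and the layer of a vertex. *)

theory Submission
  imports Defs
begin

section \<open>Distances in a connected graph\<close>

locale connected_pair_graph = pair_graph +
  assumes connected_G: "connected (with_proj G)"
begin

text \<open>A natural-number stand-in for \<open>gdist\<close>: in the connected graph it agrees
  with \<open>gdist\<close> on vertices, and it permits induction and linear arithmetic.\<close>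

definition hops :: "'a \<Rightarrow> 'a \<Rightarrow> nat" where
  "hops u v = (LEAST k. \<exists>p. awalk u p v \<and> length p = k)"

lemma hops_awalk:
  assumes "u \<in> pverts G" "v \<in> pverts G"
  obtains p where "awalk u p v" "length p = hops u v"
proof -
  have "strongly_connected (with_proj G)"
    using connected_G sym_arcs by (simp add: symmetric_connected_imp_strongly_connected)
  then have "u \<rightarrow>\<^sup>*\<^bsub>with_proj G\<^esub> v"
    using assms by (auto simp: strongly_connected_def)
  then have "\<exists>k p. awalk u p v \<and> length p = k"
    by (auto simp: reachable_awalk)
  from LeastI_ex[OF this] show thesis
    using that unfolding hops_def by blast
qed

lemma hops_le: "awalk u p v \<Longrightarrow> hops u v \<le> length p"
  unfolding hops_def by (rule Least_le) blast

lemma awalk_cost_one: "awalk_cost (\<lambda>_. 1) p = real (length p)"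
  by (induction p) auto

lemma gdist_eq_hops:
  assumes "u \<in> pverts G" "v \<in> pverts G"
  shows "gdist u v = ereal (real (hops u v))"
  unfolding gdist_def \<mu>_def awalk_cost_one
proof (rule antisym)
  obtain p where "awalk u p v" "length p = hops u v"
    using assms by (rule hops_awalk)
  then show "(INF p\<in>{p. awalk u p v}. ereal (real (length p))) \<le> ereal (real (hops u v))"
    by (intro INF_lower2[of p]) auto
qed (auto intro!: INF_greatest hops_le)

lemma hops_self [simp]: "u \<in> pverts G \<Longrightarrow> hops u u = 0"
  using hops_le[of u "[]" u] by (simp add: awalk_Nil_iff)

lemma hops_eq_0_iff: "u \<in> pverts G \<Longrightarrow> v \<in> pverts G \<Longrightarrow> hops u v = 0 \<longleftrightarrow> u = v"
  by (metis awalk_empty_ends hops_awalk hops_self length_0_conv)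

lemma hops_arc:
  assumes "u \<in> pverts G" "(v, w) \<in> parcs G"
  shows "hops u w \<le> hops u v + 1"
proof -
  obtain p where p: "awalk u p v" "length p = hops u v"
    using assms in_arcsD1 by (metis hops_awalk)
  have "awalk v [(v, w)] w"
    using assms by (auto simp: awalk_simps dest: in_arcsD2)
  with p(1) have "awalk u (p @ [(v, w)]) w"
    by (rule awalk_appendI)
  then show ?thesis
    using hops_le[of u "p @ [(v, w)]" w] p(2) by simp
qed

lemma hops_arc':
  "u \<in> pverts G \<Longrightarrow> (v, w) \<in> parcs G \<Longrightarrow> hops u v \<le> hops u w + 1"
  using hops_arc arcs_symmetric by blast

lemma hops_pred:
  assumes "u \<in> pverts G" "v \<in> pverts G" "u \<noteq> v"
  obtains w where "(w, v) \<in> parcs G" "hops u v = hops u w + 1"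
proof -
  obtain p where p: "awalk u p v" "length p = hops u v"
    using assms hops_awalk by metis
  with assms(3) obtain q e where q: "p = q @ [e]"
    by (cases p rule: rev_cases) (auto simp: awalk_Nil_iff)
  have e: "awalk u q (fst e)" "e \<in> parcs G" "snd e = v"
    using p(1) unfolding q by (auto simp: awalk_simps)
  then have arc: "(fst e, v) \<in> parcs G"
    by auto
  have "hops u v = hops u (fst e) + 1"
    using hops_le[OF e(1)] p(2) hops_arc[OF assms(1) arc] q by simp
  with arc show thesis by (rule that)
qed

text \<open>A certificate for a guessed distance function. Following \<open>pred\<close> downwards
  from \<open>v\<close> gives a walk from \<open>a\<close> of length at most \<open>f v\<close>; by
  \<open>arc\<close>, \<open>f\<close> grows by at most one per arc of a shortest walk, which gives
  the other bound.\<close>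

lemma hops_eqI:
  fixes f :: "'a \<Rightarrow> nat"
  assumes a: "a \<in> pverts G" and zero: "f a = 0"
    and arc: "\<And>u v. (u, v) \<in> parcs G \<Longrightarrow> f v \<le> f u + 1"
    and pred: "\<And>v. v \<in> pverts G \<Longrightarrow> v \<noteq> a \<Longrightarrow> \<exists>u. (u, v) \<in> parcs G \<and> f u < f v"
    and v: "v \<in> pverts G"
  shows "hops a v = f v"
proof (rule antisym)
  show "hops a v \<le> f v" using v
  proof (induction "f v" arbitrary: v rule: less_induct)
    case less
    show ?case
    proof (cases "v = a")
      case False
      then obtain u where u: "(u, v) \<in> parcs G" "f u < f v"
        using pred less.prems by blast
      then show ?thesis
        using less.hyps[of u] hops_arc[OF a u(1)] in_arcsD1 by fastforce
    qed (simp add: a)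
  qed
  show "f v \<le> hops a v" using v
  proof (induction "hops a v" arbitrary: v rule: less_induct)
    case less
    show ?case
    proof (cases "v = a")
      case False
      then obtain u where u: "(u, v) \<in> parcs G" "hops a v = hops a u + 1"
        using hops_pred[of a v] a less.prems by blast
      then show ?thesis
        using less.hyps[of u] arc[OF u(1)] in_arcsD1 by fastforce
    qed (simp add: zero)
  qed
qed

lemma hops_eq_1:
  assumes "(u, v) \<in> parcs G"
  shows "hops u v = 1"
proof -
  have "u \<in> pverts G" "v \<in> pverts G" "u \<noteq> v"
    using assms in_arcsD1 in_arcsD2 no_loops' by blast+
  then show ?thesis
    using hops_arc[of u u v] assms hops_eq_0_iff[of u v] by fastforce
qed

lemma hops_eq_1D:
  assumes "u \<in> pverts G" "v \<in> pverts G" "hops u v = 1"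
  shows "(u, v) \<in> parcs G"
proof -
  have "u \<noteq> v" using assms by auto
  then obtain w where w: "(w, v) \<in> parcs G" "hops u v = hops u w + 1"
    using assms hops_pred by metis
  then have "hops u w = 0" using assms(3) by simp
  then show ?thesis
    using w(1) assms(1) hops_eq_0_iff[of u w] in_arcsD1 by blast
qed

lemma hops_eq_2:
  assumes "(u, w) \<in> parcs G" "(w, v) \<in> parcs G" "u \<noteq> v" "(u, v) \<notin> parcs G"
  shows "hops u v = 2"
proof -
  have V: "u \<in> pverts G" "v \<in> pverts G"
    using assms in_arcsD1 in_arcsD2 by blast+
  then have "hops u v \<noteq> 0" "hops u v \<noteq> 1"
    using assms hops_eq_0_iff hops_eq_1D by blast+
  then show ?thesis
    using hops_arc[OF V(1) assms(2)] hops_eq_1[OF assms(1)] by linarith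
qed

text \<open>Induction along a shortest walk from \<open>a\<close>, whose arcs can be used in both
  directions. Writing \<open>hops a v\<close> in both inequalities fits spheres around
  \<open>a\<close> and avoids an appeal to symmetry of \<open>hops\<close>.\<close>

lemma hops_triangle:
  assumes "a \<in> pverts G" "b \<in> pverts G" "v \<in> pverts G"
  shows "hops b v \<le> hops b a + hops a v" "hops b a \<le> hops b v + hops a v"
proof -
  have "hops b v \<le> hops b a + hops a v \<and> hops b a \<le> hops b v + hops a v"
    using assms(3)
  proof (induction "hops a v" arbitrary: v rule: less_induct)
    case less
    show ?case
    proof (cases "v = a")
      case False
      then obtain u where u: "(u, v) \<in> parcs G" "hops a v = hops a u + 1"
        using hops_pred[of a v] assms(1) less.prems by blast
      then show ?thesis
        using less.hyps[of u] hops_arc[OF assms(2) u(1)] hops_arc'[OF assms(2) u(1)] in_arcsD1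
        by fastforce
    qed simp
  qed
  then show "hops b v \<le> hops b a + hops a v" "hops b a \<le> hops b v + hops a v"
    by auto
qed

section \<open>Resolving pairs and spheres\<close>

lemma resolving_set_iff_hops:
  assumes "Y \<subseteq> pverts G"
  shows "resolving_set Y \<longleftrightarrow>
    (\<forall>u \<in> pverts G. \<forall>v \<in> pverts G. u \<noteq> v \<longrightarrow> (\<exists>y \<in> Y. hops y u \<noteq> hops y v))"
proof -
  have "gdist y u = gdist y v \<longleftrightarrow> hops y u = hops y v"
    if "y \<in> Y" "u \<in> pverts G" "v \<in> pverts G" for y u v
    using gdist_eq_hops[of y u] gdist_eq_hops[of y v] that assms by auto
  then show ?thesis
    by (simp add: resolving_set_def assms)
qed

lemma resolving_set_mono:
  "resolving_set Y \<Longrightarrow> Y \<subseteq> Z \<Longrightarrow> Z \<subseteq> pverts G \<Longrightarrow> resolving_set Z"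
  unfolding resolving_set_def by blast

text \<open>The landmark \<open>a\<close> sees all of \<open>W\<close> at the same distance, so
  \<open>b\<close> alone must tell its members apart.\<close>

lemma resolving_pair_inj_on_sphere:
  assumes "resolving_set {a, b}" "W \<subseteq> pverts G" "\<And>v. v \<in> W \<Longrightarrow> hops a v = k"
  shows "inj_on (hops b) W"
proof (rule inj_onI)
  fix u v assume uv: "u \<in> W" "v \<in> W" "hops b u = hops b v"
  have ab: "{a, b} \<subseteq> pverts G" using assms(1) by (simp add: resolving_set_def)
  have "hops a u = hops a v" using assms(3) uv by simp
  then show "u = v"
    using uv assms(1,2) by (auto simp: resolving_set_iff_hops[OF ab] subset_iff)
qed

lemma resolving_pair_sphere_card:
  assumes "resolving_set {a, b}" "W \<subseteq> pverts G" "\<And>v. v \<in> W \<Longrightarrow> hops a v = k"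
  shows "card W \<le> 2 * k + 1"
proof -
  have ab: "a \<in> pverts G" "b \<in> pverts G" using assms(1) by (auto simp: resolving_set_def)
  have "hops b ` W \<subseteq> {hops b a - k .. hops b a + k}"
  proof (rule image_subsetI)
    fix v assume "v \<in> W"
    then show "hops b v \<in> {hops b a - k .. hops b a + k}"
      using hops_triangle[OF ab, of v] assms(2,3) by fastforce
  qed
  then have "card (hops b ` W) \<le> card {hops b a - k .. hops b a + k}"
    by (intro card_mono) auto
  \<comment> \<open>If \<open>hops b a < k\<close>, truncated subtraction only shortens the
    interval.\<close>
  also have "\<dots> \<le> 2 * k + 1" by simp
  finally show ?thesis
    using card_image[OF resolving_pair_inj_on_sphere[OF assms]] by simp
qed

end

section \<open>Adjacency in the graph\<close>

lemma connected_pair_graph_Delta: "2 \<le> n \<Longrightarrow> connected_pair_graph (Delta n)"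
  by (simp add: connected_pair_graph_def connected_pair_graph_axioms_def
      pair_graph_Delta connected_Delta)

lemma in_pverts_Delta [simp]:
  "P t \<in> pverts (Delta n) \<longleftrightarrow> t \<in> {1..n}"
  "Q t \<in> pverts (Delta n) \<longleftrightarrow> t \<in> {1..n}"
  "R t \<in> pverts (Delta n) \<longleftrightarrow> t \<in> {1..n}"
  "S t \<in> pverts (Delta n) \<longleftrightarrow> t \<in> {1..n}"
  by (auto simp: Delta_def ladder_vertices_def)

lemma in_parcs_Delta [simp]:
  "(P t, P u) \<in> parcs (Delta n) \<longleftrightarrow> t \<in> {1..n} \<and> u = nxt n t \<or> u \<in> {1..n} \<and> t = nxt n u"
  "(P t, Q u) \<in> parcs (Delta n) \<longleftrightarrow> t \<in> {1..n} \<and> u = t"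
  "(Q t, P u) \<in> parcs (Delta n) \<longleftrightarrow> t \<in> {1..n} \<and> u = t"
  "(P t, R u) \<notin> parcs (Delta n)" "(R u, P t) \<notin> parcs (Delta n)"
  "(P t, S u) \<notin> parcs (Delta n)" "(S u, P t) \<notin> parcs (Delta n)"
  "(Q t, Q u) \<notin> parcs (Delta n)"
  "(Q t, R u) \<in> parcs (Delta n) \<longleftrightarrow> u \<in> {1..n} \<and> (t = u \<or> t = nxt n u)"
  "(R u, Q t) \<in> parcs (Delta n) \<longleftrightarrow> u \<in> {1..n} \<and> (t = u \<or> t = nxt n u)"
  "(Q t, S u) \<notin> parcs (Delta n)" "(S u, Q t) \<notin> parcs (Delta n)"
  "(R t, R u) \<notin> parcs (Delta n)"
  "(R t, S u) \<in> parcs (Delta n) \<longleftrightarrow> u \<in> {1..n} \<and> (t = u \<or> t = nxt n u)"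
  "(S u, R t) \<in> parcs (Delta n) \<longleftrightarrow> u \<in> {1..n} \<and> (t = u \<or> t = nxt n u)"
  "(S t, S u) \<notin> parcs (Delta n)"
  by (auto simp: Delta_def Delta_edges_def Gamma_edges_def)

lemma nxt_if: "t \<in> {1..n} \<Longrightarrow> nxt n t = (if t = n then 1 else Suc t)"
  by (auto simp: nxt_less nxt_self)

lemma nxt_inj:
  "nxt n t = nxt n u \<Longrightarrow> t \<in> {1..n} \<Longrightarrow> u \<in> {1..n} \<Longrightarrow> t = u"
  by (cases "t = n"; cases "u = n") (auto simp: nxt_less nxt_self)

lemma in_parcs_Delta_Q:
  assumes "(x, Q (nxt n u)) \<in> parcs (Delta n)" "u \<in> {1..n}"
  shows "x \<in> {P (nxt n u), R u, R (nxt n u)}"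
proof (cases x)
  case (R v)
  then have "v \<in> {1..n}" "nxt n u = v \<or> nxt n u = nxt n v"
    using assms by simp_all
  then show ?thesis
    using R nxt_inj[of n u v] assms(2) by blast
qed (use assms in auto)

text \<open>The indices t - 2, t - 1, t + 1, t + 2 get names, so that later proofs need no case
  split at the wraparound. Including \<open>nxt n t4\<close> among the distinct indices rules out,
  for example, an arc from \<open>P t4\<close> to \<open>P t\<close>.\<close>

lemma consecutive_indices:
  assumes "6 \<le> n" "t \<in> {1..n}"
  obtains t0 t1 t3 t4 where
    "{t0, t1, t3, t4} \<subseteq> {1..n}" "distinct [t0, t1, t, t3, t4, nxt n t4]"
    "nxt n t0 = t1" "nxt n t1 = t" "nxt n t = t3" "nxt n t3 = t4"
proof -
  have *: "\<exists>u\<in>{1..n}. nxt n u = v" if "v \<in> {1..n}" for v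
  proof (cases "v = 1")
    case True
    then show ?thesis using assms(1) nxt_self[of n] by (intro bexI[of _ n]) auto
  next
    case False
    then show ?thesis using that nxt_less[of "v - 1" n] by (intro bexI[of _ "v - 1"]) auto
  qed
  obtain t1 where t1: "t1 \<in> {1..n}" "nxt n t1 = t" using * assms(2) by blast
  obtain t0 where t0: "t0 \<in> {1..n}" "nxt n t0 = t1" using * t1(1) by blast
  obtain t3 where t3: "t3 \<in> {1..n}" "nxt n t = t3"
    using assms nxt_in[of t n] by auto
  obtain t4 where t4: "t4 \<in> {1..n}" "nxt n t3 = t4"
    using t3 nxt_in[of t3 n] by auto
  have "t1 = (if t0 = n then 1 else Suc t0)" "t = (if t1 = n then 1 else Suc t1)"
    "t3 = (if t = n then 1 else Suc t)" "t4 = (if t3 = n then 1 else Suc t3)"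
    "nxt n t4 = (if t4 = n then 1 else Suc t4)"
    using nxt_if[of t0] nxt_if[of t1] nxt_if[of t] nxt_if[of t3] nxt_if[of t4] t0 t1 t3 t4 assms(2)
    by simp_all
  then have "distinct [t0, t1, t, t3, t4, nxt n t4]"
    using assms(1) by simp
  then show thesis
    using that[of t0 t1 t3 t4] t0 t1 t3 t4 by blast
qed

section \<open>No two vertices resolve the graph\<close>

text \<open>The variables stand for distances from the second landmark, the first one being \<open>S t\<close>:
  \<open>r0\<close>, \<open>r1\<close>, \<open>rm\<close>, \<open>rp\<close> to \<open>R t\<close>, \<open>R (t + 1)\<close>, \<open>R (t - 1)\<close>, \<open>R (t + 2)\<close>;
  \<open>qi\<close>, \<open>pi\<close> to \<open>Q (t + i)\<close>, \<open>P (t + i)\<close>; \<open>s0\<close>, \<open>s1\<close> to \<open>S (t - 1)\<close>, \<open>S (t + 1)\<close>;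
  or to the mirror images of these vertices.\<close>

lemma steep_sphere_contradiction:
  fixes r0 r1 q0 q1 q2 s0 s1 rm rp p0 p1 p2 :: nat
  assumes r: "r0 < r1" "r1 \<le> r0 + 2"
    and q0: "q0 \<le> r0 + 1" "r0 \<le> q0 + 1" "q0 \<le> rm + 1"
      "q0 = p0 + 1 \<or> q0 = rm + 1 \<or> q0 = r0 + 1"
    and s0: "s0 \<le> r0 + 1" "r0 \<le> s0 + 1" "s0 = rm + 1 \<or> s0 = r0 + 1"
    and q1: "q1 \<le> r0 + 1" "r1 \<le> q1 + 1"
    and q2: "q2 \<le> r1 + 1" "r1 \<le> q2 + 1" "q2 \<le> rp + 1" "q2 \<le> p2 + 1"
    and s1: "s1 \<le> r1 + 1" "r1 \<le> s1 + 1" "s1 = r1 + 1 \<or> s1 = rp + 1"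
    and p: "p1 \<le> p0 + 1" "p2 \<le> p1 + 1"
    and distinct: "distinct [q0, q1, q2, s0, s1]"
  shows False
proof -
  \<comment> \<open>If \<open>r0\<close> and \<open>r1\<close> differed by one only, the five
    distinct distances would lie among four values.\<close>
  have "r1 = r0 + 2"
  proof (rule ccontr)
    assume "r1 \<noteq> r0 + 2"
    then have "set [q0, q1, q2, s0, s1] \<subseteq> {r0 - 1, r0, r0 + 1, r0 + 2}"
      using r q0 s0 q1 q2 s1 by auto
    then have "card (set [q0, q1, q2, s0, s1]) \<le> card {r0 - 1, r0, r0 + 1, r0 + 2}"
      by (intro card_mono) auto
    also have "\<dots> \<le> 4"
      by (simp add: card_insert_if)
    finally show False
      using distinct_card[OF distinct] by simp
  qed
  moreover from this have "q1 = r0 + 1" using q1 by simp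
  moreover have "q0 \<noteq> q1" "s0 \<noteq> q1" "q2 \<noteq> q1" "s1 \<noteq> q1" "q0 \<noteq> s0" "q2 \<noteq> s1"
    using distinct by auto
  \<comment> \<open>Both neighbours of the S vertex behind \<open>s0\<close> are also neighbours of
    the Q vertex behind \<open>q0\<close>; likewise for \<open>s1\<close> and \<open>q2\<close>.
    Distinctness makes both inequalities strict.\<close>
  moreover have "q0 \<le> s0" using q0(1,3) s0(3) by auto
  moreover have "q2 \<le> s1" using q2(1,3) s1(3) by auto
  ultimately have "q0 + 1 = r0" "s0 = r0" "q2 = r0 + 2"
    using q0(2) s0(1) q2(2) s1(1) by linarith+
  \<comment> \<open>Neither R neighbour is close enough to account for \<open>q0\<close>, so a
    shortest walk enters that Q vertex from its P neighbour. Two steps along the P cycle then give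
    \<open>p2 \<le> r0\<close>, too small for \<open>q2 = r0 + 2\<close>.\<close>
  moreover from this have "rm + 1 = r0" using s0(3) by auto
  ultimately have "p0 + 2 = r0" using q0(4) by auto
  then show False
    using \<open>q2 = r0 + 2\<close> q2(4) p by simp
qed

context
  fixes n :: nat
  assumes n: "6 \<le> n"
begin

interpretation connected_pair_graph "Delta n"
  using n by (simp add: connected_pair_graph_Delta)

lemma resolving_pair_not_P: "\<not> resolving_set {P t, b}"
proof
  assume res: "resolving_set {P t, b}"
  then have t: "t \<in> {1..n}" by (simp add: resolving_set_def)
  obtain t0 t1 t3 t4 where w: "{t0, t1, t3, t4} \<subseteq> {1..n}" "distinct [t0, t1, t, t3, t4, nxt n t4]"
    "nxt n t0 = t1" "nxt n t1 = t" "nxt n t = t3" "nxt n t3 = t4"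
    using consecutive_indices[OF n t] .
  let ?W = "{P t0, P t4, Q t1, Q t3, R t1, R t}"
  have "hops (P t) v = 2" if "v \<in> ?W" for v
    using that w t
      hops_eq_2[of "P t" "P t1" "P t0"] hops_eq_2[of "P t" "P t3" "P t4"]
      hops_eq_2[of "P t" "P t1" "Q t1"] hops_eq_2[of "P t" "P t3" "Q t3"]
      hops_eq_2[of "P t" "Q t" "R t1"] hops_eq_2[of "P t" "Q t" "R t"]
    by auto
  moreover have "?W \<subseteq> pverts (Delta n)" "card ?W = 6"
    using w t by auto
  ultimately show False
    using resolving_pair_sphere_card[OF res, of ?W 2] by simp
qed

lemma resolving_pair_not_Q: "\<not> resolving_set {Q t, b}"
proof
  assume res: "resolving_set {Q t, b}"
  then have t: "t \<in> {1..n}" by (simp add: resolving_set_def)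
  obtain t0 t1 t3 t4 where w: "{t0, t1, t3, t4} \<subseteq> {1..n}" "distinct [t0, t1, t, t3, t4, nxt n t4]"
    "nxt n t0 = t1" "nxt n t1 = t" "nxt n t = t3" "nxt n t3 = t4"
    using consecutive_indices[OF n t] .
  let ?W = "{P t1, P t3, Q t1, Q t3, S t1, S t}"
  have "hops (Q t) v = 2" if "v \<in> ?W" for v
    using that w t
      hops_eq_2[of "Q t" "P t" "P t1"] hops_eq_2[of "Q t" "P t" "P t3"]
      hops_eq_2[of "Q t" "R t1" "Q t1"] hops_eq_2[of "Q t" "R t" "Q t3"]
      hops_eq_2[of "Q t" "R t1" "S t1"] hops_eq_2[of "Q t" "R t" "S t"]
    by auto
  moreover have "?W \<subseteq> pverts (Delta n)" "card ?W = 6"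
    using w t by auto
  ultimately show False
    using resolving_pair_sphere_card[OF res, of ?W 2] by simp
qed

lemma resolving_pair_not_R: "\<not> resolving_set {R t, b}"
proof
  assume res: "resolving_set {R t, b}"
  then have t: "t \<in> {1..n}" by (simp add: resolving_set_def)
  obtain t0 t1 t3 t4 where w: "{t0, t1, t3, t4} \<subseteq> {1..n}" "distinct [t0, t1, t, t3, t4, nxt n t4]"
    "nxt n t0 = t1" "nxt n t1 = t" "nxt n t = t3" "nxt n t3 = t4"
    using consecutive_indices[OF n t] .
  let ?W = "{Q t, Q t3, S t1, S t}"
  have "hops (R t) v = 1" if "v \<in> ?W" for v
    using that w t by (intro hops_eq_1) auto
  moreover have "?W \<subseteq> pverts (Delta n)" "card ?W = 4"
    using w t by auto
  ultimately show False
    using resolving_pair_sphere_card[OF res, of ?W 1] by simp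
qed

text \<open>The five distances from \<open>b\<close> to the 2-sphere around \<open>S t\<close> must exhaust
  \<open>{D - 2..D + 2}\<close>, where \<open>D\<close> is the distance from \<open>b\<close> to \<open>S t\<close>. This makes the distances
  increase from one end of the sphere to the other so fast that the path through \<open>P t\<close>,
  \<open>P (t + 1)\<close>, \<open>P (t + 2)\<close> is a forbidden short cut.\<close>

lemma resolving_pair_not_S: "\<not> resolving_set {S t, S s}"
proof
  assume res: "resolving_set {S t, S s}"
  then have t: "t \<in> {1..n}" and s: "s \<in> {1..n}" by (simp_all add: resolving_set_def)
  obtain t0 t1 t3 t4 where w: "{t0, t1, t3, t4} \<subseteq> {1..n}" "distinct [t0, t1, t, t3, t4, nxt n t4]"
    "nxt n t0 = t1" "nxt n t1 = t" "nxt n t = t3" "nxt n t3 = t4"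
    using consecutive_indices[OF n t] .
  let ?W = "{Q t, Q t3, Q t4, S t1, S t3}"
  let ?h = "hops (S s)"
  have sphere: "hops (S t) v = 2" if "v \<in> ?W" for v
    using that w t
      hops_eq_2[of "S t" "R t" "Q t"] hops_eq_2[of "S t" "R t" "Q t3"]
      hops_eq_2[of "S t" "R t3" "Q t4"] hops_eq_2[of "S t" "R t" "S t1"]
      hops_eq_2[of "S t" "R t3" "S t3"]
    by auto
  have W: "?W \<subseteq> pverts (Delta n)" "card ?W = 5"
    using w t by auto
  have inj: "inj_on ?h ?W"
    using resolving_pair_inj_on_sphere[OF res W(1)] sphere by blast
  have near: "?h v \<le> ?h u + 1 \<and> ?h u \<le> ?h v + 1" if "(u, v) \<in> parcs (Delta n)" for u v
    using that hops_arc[of "S s" u v] hops_arc'[of "S s" u v] s by simp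
  show False
  proof (cases "S s \<in> ?W")
    \<comment> \<open>An S vertex is adjacent to R vertices only, so distance 1 does not occur on
      \<open>?W\<close>. Distances are at most 2 + 2, which leaves four values for five
      vertices.\<close>
    case True
    have "?h ` ?W \<subseteq> {0, 2, 3, 4}"
    proof (rule image_subsetI)
      fix v assume v: "v \<in> ?W"
      have V: "S s \<in> pverts (Delta n)" "S t \<in> pverts (Delta n)" "v \<in> pverts (Delta n)"
        using W(1) v s t by auto
      have "?h (S t) \<le> 2"
        using hops_triangle(2)[OF V(2,1,1)] sphere[OF True] V(1) by simp
      then have "?h v \<le> 4"
        using hops_triangle(1)[OF V(2,1,3)] sphere[OF v] by linarith
      moreover have "?h v \<noteq> 1"
        using hops_eq_1D[OF V(1,3)] v by auto
      ultimately show "?h v \<in> {0, 2, 3, 4}" by auto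
    qed
    then have "card (?h ` ?W) \<le> card {0::nat, 2, 3, 4}"
      by (intro card_mono) auto
    then show False
      using card_image[OF inj] W(2) by simp
  next
    case False
    \<comment> \<open>The two neighbours of \<open>S t\<close> must also be separated by
      \<open>S s\<close>; which of them is nearer decides the direction of increase.\<close>
    have "hops (S t) v = 1" if "v \<in> {R t, R t3}" for v
      using that w(5) t hops_eq_1[of "S t" "R t"] hops_eq_1[of "S t" "R t3"] by auto
    moreover have "{R t, R t3} \<subseteq> pverts (Delta n)"
      using w(5) t nxt_in[of t n] by simp
    ultimately have "inj_on ?h {R t, R t3}"
      using resolving_pair_inj_on_sphere[OF res] by blast
    then have R: "?h (R t) \<noteq> ?h (R t3)"
      using w by (auto simp: inj_on_def)
    have distinct: "distinct (map ?h [Q t, Q t3, Q t4, S t1, S t3])"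
      using inj w by (auto simp: distinct_map)
    \<comment> \<open>Since \<open>S s\<close> lies outside \<open>?W\<close>, a shortest walk to
      each sphere vertex has a last arc. This and the next three facts list where it can
      start.\<close>
    have S1: "?h (S t1) = ?h (R t1) + 1 \<or> ?h (S t1) = ?h (R t) + 1"
    proof -
      obtain x where x: "(x, S t1) \<in> parcs (Delta n)" "?h (S t1) = ?h x + 1"
        using hops_pred[of "S s" "S t1"] s w False by auto
      then show ?thesis using w by (cases x) auto
    qed
    have S3: "?h (S t3) = ?h (R t3) + 1 \<or> ?h (S t3) = ?h (R t4) + 1"
    proof -
      obtain x where x: "(x, S t3) \<in> parcs (Delta n)" "?h (S t3) = ?h x + 1"
        using hops_pred[of "S s" "S t3"] s w False by auto
      then show ?thesis using w by (cases x) auto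
    qed
    have Q0: "?h (Q t) = ?h (P t) + 1 \<or> ?h (Q t) = ?h (R t1) + 1 \<or> ?h (Q t) = ?h (R t) + 1"
    proof -
      obtain x where x: "(x, Q t) \<in> parcs (Delta n)" "?h (Q t) = ?h x + 1"
        using hops_pred[of "S s" "Q t"] s t by auto
      then have "x \<in> {P t, R t1, R t}"
        using in_parcs_Delta_Q[of x n t1] w(1,4) by simp
      then show ?thesis using x(2) by auto
    qed
    have Q4: "?h (Q t4) = ?h (P t4) + 1 \<or> ?h (Q t4) = ?h (R t3) + 1 \<or> ?h (Q t4) = ?h (R t4) + 1"
    proof -
      obtain x where x: "(x, Q t4) \<in> parcs (Delta n)" "?h (Q t4) = ?h x + 1"
        using hops_pred[of "S s" "Q t4"] s w by auto
      then have "x \<in> {P t4, R t3, R t4}"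
        using in_parcs_Delta_Q[of x n t3] w(1,6) by simp
      then show ?thesis using x(2) by auto
    qed
    have "(S t, R t) \<in> parcs (Delta n)" "(S t, R t3) \<in> parcs (Delta n)"
      "(R t, Q t) \<in> parcs (Delta n)" "(R t, Q t3) \<in> parcs (Delta n)"
      "(R t, S t1) \<in> parcs (Delta n)" "(R t3, Q t3) \<in> parcs (Delta n)"
      "(R t3, Q t4) \<in> parcs (Delta n)" "(R t3, S t3) \<in> parcs (Delta n)"
      "(R t1, Q t) \<in> parcs (Delta n)" "(R t1, S t1) \<in> parcs (Delta n)"
      "(R t4, Q t4) \<in> parcs (Delta n)" "(R t4, S t3) \<in> parcs (Delta n)"
      "(P t, Q t) \<in> parcs (Delta n)" "(P t4, Q t4) \<in> parcs (Delta n)"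
      "(P t, P t3) \<in> parcs (Delta n)" "(P t3, P t4) \<in> parcs (Delta n)"
      using w t by auto
    note near = this[THEN near]
    have "?h (R t3) \<le> ?h (R t) + 2" "?h (R t) \<le> ?h (R t3) + 2"
      using near(1,2) by linarith+
    note facts = this near S1 S3 Q0 Q4
    show False
    proof (cases "?h (R t) < ?h (R t3)")
      case True
      have "distinct [?h (Q t), ?h (Q t3), ?h (Q t4), ?h (S t1), ?h (S t3)]"
        using distinct by simp
      with facts True show False
        by (intro steep_sphere_contradiction[of "?h (R t)" "?h (R t3)" "?h (Q t)" "?h (R t1)" "?h (P t)"
              "?h (S t1)" "?h (Q t3)" "?h (Q t4)" "?h (R t4)" "?h (P t4)" "?h (S t3)" "?h (P t3)"])
          blast+
    next
      \<comment> \<open>The mirror image: the reflection fixing \<open>S t\<close>,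
        \<open>Q t3\<close> and \<open>P t3\<close> exchanges the ends of the sphere.\<close>
      case False
      then have "?h (R t3) < ?h (R t)"
        using R by linarith
      moreover have "distinct [?h (Q t4), ?h (Q t3), ?h (Q t), ?h (S t3), ?h (S t1)]"
        using distinct by auto
      ultimately show False using facts
        by (intro steep_sphere_contradiction[of "?h (R t3)" "?h (R t)" "?h (Q t4)" "?h (R t4)" "?h (P t4)"
              "?h (S t3)" "?h (Q t3)" "?h (Q t)" "?h (R t1)" "?h (P t)" "?h (S t1)" "?h (P t3)"])
          blast+
    qed
  qed
qed

lemma card_resolving_set_ge_3:
  assumes "resolving_set Y"
  shows "3 \<le> card Y"
proof (rule ccontr)
  assume "\<not> 3 \<le> card Y"
  moreover have Y: "Y \<subseteq> pverts (Delta n)"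
    using assms by (simp add: resolving_set_def)
  then have "finite Y"
    using pair_finite_verts finite_subset by blast
  ultimately consider "Y = {}" | a where "Y = {a}" | a b where "Y = {a, b}"
    by (metis One_nat_def card_0_eq card_1_singletonE card_2_iff less_Suc_eq less_one not_le_imp_less
        numeral_2_eq_2 numeral_3_eq_3)
  then obtain a b where ab: "a \<in> pverts (Delta n)" "b \<in> pverts (Delta n)" "Y \<subseteq> {a, b}"
  proof cases
    case 1
    then show thesis using that[of "P 1" "P 1"] n by simp
  qed (use that Y in auto)
  \<comment> \<open>Both orders are recorded because the lemmas for P, Q and R constrain the first
    landmark. The case \<open>a = b\<close> is included.\<close>
  then have "resolving_set {a, b}" "resolving_set {b, a}"
    using resolving_set_mono[OF assms, of "{a, b}"] by (simp_all add: insert_commute)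
  then show False
    using resolving_pair_not_P resolving_pair_not_Q resolving_pair_not_R resolving_pair_not_S
    by (cases a; cases b) auto
qed

end

section \<open>Explicit distances from a vertex of the P cycle\<close>

text \<open>Distance on the n-cycle; the sum of the two truncated differences is the absolute
  difference of the indices.\<close>

definition arc_dist :: "nat \<Rightarrow> nat \<Rightarrow> nat \<Rightarrow> nat" where
  "arc_dist n a t = min ((t - a) + (a - t)) (n - ((t - a) + (a - t)))"

definition rung_dist :: "nat \<Rightarrow> nat \<Rightarrow> nat \<Rightarrow> nat" where
  "rung_dist n a t = min (arc_dist n a t) (arc_dist n a (nxt n t))"

text \<open>The vertex \<open>S t\<close> is reached through \<open>Q t\<close>, \<open>Q (t + 1)\<close> or \<open>Q (t + 2)\<close>. Unless it vanishes,
  the arc distance of the middle index exceeds the least of the three by one.\<close>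

definition tip_dist :: "nat \<Rightarrow> nat \<Rightarrow> nat \<Rightarrow> nat" where
  "tip_dist n a t = arc_dist n a t - 1"

text \<open>The candidate for \<open>hops (P a)\<close>: a walk along the P cycle followed by 1, 2
  or 3 steps outwards. When \<open>nxt n t = a\<close>, truncation in \<open>tip_dist\<close> gives
  the correct value 3 at \<open>S t\<close>.\<close>

fun P_dist :: "nat \<Rightarrow> nat \<Rightarrow> vertex \<Rightarrow> nat" where
  "P_dist n a (P t) = arc_dist n a t"
| "P_dist n a (Q t) = arc_dist n a t + 1"
| "P_dist n a (R t) = rung_dist n a t + 2"
| "P_dist n a (S t) = tip_dist n a (nxt n t) + 3"

lemma arc_dist_self [simp]: "arc_dist n a a = 0"
  by (simp add: arc_dist_def)

lemma arc_dist_nxt: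
  assumes "a \<in> {1..n}" "t \<in> {1..n}"
  shows "arc_dist n a (nxt n t) \<le> arc_dist n a t + 1"
    "arc_dist n a t \<le> arc_dist n a (nxt n t) + 1"
proof -
  have "arc_dist n a (nxt n t) \<le> arc_dist n a t + 1 \<and> arc_dist n a t \<le> arc_dist n a (nxt n t) + 1"
    using assms by (cases "t = n"; cases "a \<le> t") (auto simp: arc_dist_def nxt_if min_def)
  then show "arc_dist n a (nxt n t) \<le> arc_dist n a t + 1"
    "arc_dist n a t \<le> arc_dist n a (nxt n t) + 1" by auto
qed

text \<open>One of the two cyclic neighbours of \<open>t\<close> lies on a shorter arc to
  \<open>a\<close>; comparing twice the index difference with \<open>n\<close> decides
  which.\<close>

lemma arc_dist_pred:
  assumes "a \<in> {1..n}" "t \<in> {1..n}" "t \<noteq> a"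
  obtains "arc_dist n a (nxt n t) < arc_dist n a t"
  | u where "u \<in> {1..n}" "nxt n u = t" "arc_dist n a u < arc_dist n a t"
proof -
  define u where "u = (if t = 1 then n else t - 1)"
  have u: "u \<in> {1..n}" using assms by (auto simp: u_def)
  moreover have "nxt n u = t" using assms nxt_if[OF u] by (auto simp: u_def)
  moreover have "arc_dist n a (nxt n t) < arc_dist n a t \<or> arc_dist n a u < arc_dist n a t"
  proof (cases "a < t")
    case True
    then have u': "u = t - 1" using assms(1) by (auto simp: u_def)
    show ?thesis
    proof (cases "2 * (t - a) \<le> n")
      case near: True
      then have "arc_dist n a u < arc_dist n a t"
        using True assms(1) by (simp add: arc_dist_def u')
      then show ?thesis ..
    next
      case far: False
      then have "arc_dist n a (nxt n t) < arc_dist n a t"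
        using True assms(1,2) by (cases "t = n") (simp_all add: arc_dist_def nxt_if)
      then show ?thesis ..
    qed
  next
    case False
    then have "t < a" "t < n" using assms by simp_all
    then have t': "nxt n t = Suc t" by (simp add: nxt_less)
    show ?thesis
    proof (cases "2 * (a - t) \<le> n")
      case near: True
      then have "arc_dist n a (nxt n t) < arc_dist n a t"
        using \<open>t < a\<close> assms(1) by (simp add: arc_dist_def t')
      then show ?thesis ..
    next
      case far: False
      then have "arc_dist n a u < arc_dist n a t"
        using \<open>t < a\<close> assms(1,2) by (cases "t = 1") (simp_all add: arc_dist_def u_def)
      then show ?thesis ..
    qed
  qed
  ultimately show thesis using that by blast
qed

lemma P_dist_arc:
  assumes "a \<in> {1..n}" "(u, v) \<in> parcs (Delta n)"
  shows "P_dist n a v \<le> P_dist n a u + 1"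
proof -
  have nxt: "nxt n t \<in> {1..n}" if "t \<in> {1..n}" for t
    using that nxt_in by simp
  \<comment> \<open>The absolute value over the integers treats both orientations of an edge at
    once.\<close>
  have edge: "\<bar>int (P_dist n a u) - int (P_dist n a v)\<bar> \<le> 1" if uv: "(u, v) \<in> Delta_edges n" for u v
  proof -
    obtain t where t: "t \<in> {1..n}"
      and "(u, v) \<in> {(P t, P (nxt n t)), (P t, Q t), (Q t, R t), (R t, S t), (S t, R (nxt n t)),
        (R t, Q (nxt n t))}"
      using uv by (fastforce simp: Delta_edges_def Gamma_edges_def)
    then consider "u = P t" "v = P (nxt n t)" | "u = P t" "v = Q t" | "u = Q t" "v = R t"
      | "u = R t" "v = S t" | "u = S t" "v = R (nxt n t)" | "u = R t" "v = Q (nxt n t)"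
      by blast
    then show ?thesis
      using arc_dist_nxt[OF assms(1) t] arc_dist_nxt[OF assms(1) nxt[OF t]]
      by cases (simp_all add: rung_dist_def tip_dist_def)
  qed
  have "(u, v) \<in> Delta_edges n \<or> (v, u) \<in> Delta_edges n"
    using assms(2) by (simp add: Delta_def)
  then show ?thesis
    using edge[of u v] edge[of v u] by linarith
qed

lemma P_dist_pred:
  assumes a: "a \<in> {1..n}" and v: "v \<in> pverts (Delta n)" "v \<noteq> P a"
  shows "\<exists>u. (u, v) \<in> parcs (Delta n) \<and> P_dist n a u < P_dist n a v"
proof (cases v)
  case (P t)
  then have t: "t \<in> {1..n}" "t \<noteq> a" using v by auto
  show ?thesis
  proof (rule arc_dist_pred[OF a t])
    assume "arc_dist n a (nxt n t) < arc_dist n a t"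
    then show ?thesis using P t by (intro exI[of _ "P (nxt n t)"]) simp
  next
    fix u assume "u \<in> {1..n}" "nxt n u = t" "arc_dist n a u < arc_dist n a t"
    then show ?thesis using P t by (intro exI[of _ "P u"]) simp
  qed
next
  case (Q t)
  then show ?thesis using v by (intro exI[of _ "P t"]) simp
next
  case (R t)
  then have t: "t \<in> {1..n}" using v by simp
  show ?thesis
  proof (cases "arc_dist n a t \<le> arc_dist n a (nxt n t)")
    case True
    then show ?thesis using R t by (intro exI[of _ "Q t"]) (simp add: rung_dist_def)
  next
    case False
    then show ?thesis using R t by (intro exI[of _ "Q (nxt n t)"]) (simp add: rung_dist_def)
  qed
next
  case (S t)
  then have t: "t \<in> {1..n}" and t': "nxt n t \<in> {1..n}" using v nxt_in[of t n] by simp_all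
  show ?thesis
  \<comment> \<open>The two neighbours of \<open>S t\<close> are \<open>R t\<close> and
    \<open>R (nxt n t)\<close>. The second one works if its two Q neighbours include one that is
    close enough; otherwise the index nearer to \<open>a\<close> must be \<open>t\<close>.\<close>
  proof (cases "nxt n t = a \<or> arc_dist n a (nxt n (nxt n t)) < arc_dist n a (nxt n t)")
    case True
    then show ?thesis
      using S t by (intro exI[of _ "R (nxt n t)"]) (auto simp: rung_dist_def tip_dist_def)
  next
    case False
    then obtain u where "u \<in> {1..n}" "nxt n u = nxt n t" "arc_dist n a u < arc_dist n a (nxt n t)"
      using arc_dist_pred[OF a t'] by metis
    then have "arc_dist n a t < arc_dist n a (nxt n t)"
      using nxt_inj[of n u t] t by simp
    then show ?thesis
      using S t by (intro exI[of _ "R t"]) (auto simp: rung_dist_def tip_dist_def)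
  qed
qed

section \<open>Three landmarks on the inner cycle\<close>

text \<open>With \<open>m = n div 2\<close>, index \<open>m + 2\<close> is a farthest index from 2,
  the midpoint of 1 and 3. Away from the landmarks and their antipodes, the first coordinate minus
  the second is 2 or -2 according to the side of the cycle, the first plus the third then gives the
  layer, and the first gives the index.\<close>

definition landmark_code :: "nat \<Rightarrow> nat \<Rightarrow> vertex \<Rightarrow> nat \<times> nat \<times> nat" where
  "landmark_code n m v = (P_dist n 1 v, P_dist n 3 v, P_dist n (m + 2) v)"

context
  fixes n m :: nat
  assumes n: "6 \<le> n" and m: "m = n div 2"
begin

lemma m_bounds: "2 * m \<le> n" "n \<le> 2 * m + 1" "3 \<le> m"
  using n by (auto simp: m)

lemma arc_dist_landmarks:
  assumes "t \<in> {1..n}"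
  shows "arc_dist n 1 t = (if t \<le> m + 1 then t - 1 else n + 1 - t)"
    "arc_dist n 3 t = (if t \<le> 3 then 3 - t else if t \<le> m + 3 \<and> t \<le> n then t - 3 else n + 3 - t)"
    "arc_dist n (m + 2) t =
      (if t = 1 then n - m - 1 else if t \<le> m + 2 then m + 2 - t else t - m - 2)"
  using assms m_bounds by (auto simp: arc_dist_def min_def)

text \<open>The cycle is cut into zones on which all three distances are affine in \<open>t\<close>.
  The equations use sums only, so that linear arithmetic meets no truncated subtraction.\<close>

lemma arc_dist_cases:
  assumes "t \<in> {1..n}"
  shows
    "t = 1 \<and> arc_dist n 1 t = 0 \<and> arc_dist n 3 t = 2 \<and> arc_dist n (m + 2) t + m + 1 = n \<or>
     t = 2 \<and> arc_dist n 1 t = 1 \<and> arc_dist n 3 t = 1 \<and> arc_dist n (m + 2) t = m \<or>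
     3 \<le> t \<and> t \<le> m + 1 \<and>
       arc_dist n 1 t + 1 = t \<and> arc_dist n 3 t + 3 = t \<and> arc_dist n (m + 2) t + t = m + 2 \<or>
     t = m + 2 \<and>
       arc_dist n 1 t + m + 1 = n \<and> arc_dist n 3 t + 1 = m \<and> arc_dist n (m + 2) t = 0 \<or>
     t = m + 3 \<and> arc_dist n 1 t + m + 2 = n \<and> arc_dist n 3 t = m \<and> arc_dist n (m + 2) t = 1 \<or>
     m + 4 \<le> t \<and> t \<le> n \<and>
       arc_dist n 1 t + t = n + 1 \<and> arc_dist n 3 t + t = n + 3 \<and> arc_dist n (m + 2) t + m + 2 = t"
proof -
  have "t = 1 \<or> t = 2 \<or> 3 \<le> t \<and> t \<le> m + 1 \<or> t = m + 2 \<or> t = m + 3 \<or> m + 4 \<le> t \<and> t \<le> n"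
    using assms by auto
  then show ?thesis
    using m_bounds unfolding arc_dist_landmarks[OF assms] by (elim disjE conjE) simp_all
qed

lemma rung_dist_cases:
  assumes "t \<in> {1..n}"
  shows
    "t = 1 \<and> rung_dist n 1 t = 0 \<and> rung_dist n 3 t = 1 \<and> rung_dist n (m + 2) t + m + 1 = n \<or>
     t = 2 \<and> rung_dist n 1 t = 1 \<and> rung_dist n 3 t = 0 \<and> rung_dist n (m + 2) t + 1 = m \<or>
     3 \<le> t \<and> t \<le> m \<and>
       rung_dist n 1 t + 1 = t \<and> rung_dist n 3 t + 3 = t \<and> rung_dist n (m + 2) t + t = m + 1 \<or>
     t = m + 1 \<and>
       rung_dist n 1 t + m + 1 = n \<and> rung_dist n 3 t + 2 = m \<and> rung_dist n (m + 2) t = 0 \<or>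
     t = m + 2 \<and>
       rung_dist n 1 t + m + 2 = n \<and> rung_dist n 3 t + 1 = m \<and> rung_dist n (m + 2) t = 0 \<or>
     m + 3 \<le> t \<and> t \<le> n \<and>
       rung_dist n 1 t + t = n \<and> rung_dist n 3 t + t = n + 2 \<and> rung_dist n (m + 2) t + m + 2 = t"
proof -
  have t': "nxt n t \<in> {1..n}" using assms nxt_in[of t n] by simp
  \<comment> \<open>The index \<open>n\<close> is split off because \<open>nxt\<close> wraps around
    there.\<close>
  have "t = 1 \<or> t = 2 \<or> 3 \<le> t \<and> t \<le> m \<or> t = m + 1 \<or> t = m + 2 \<or>
      m + 3 \<le> t \<and> t < n \<or> m + 3 \<le> t \<and> t = n"
    using assms by auto
  then show ?thesis
    using m_bounds nxt_if[OF assms]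
    unfolding rung_dist_def arc_dist_landmarks[OF assms] arc_dist_landmarks[OF t']
    by (elim disjE conjE; auto)
qed

text \<open>Here \<open>t\<close> is the middle index \<open>nxt n\<close> of an S vertex. Index 3
  is a zone of its own because the subtraction in \<open>tip_dist\<close> truncates at a
  landmark.\<close>

lemma tip_dist_cases:
  assumes "t \<in> {1..n}"
  shows
    "t = 1 \<and> tip_dist n 1 t = 0 \<and> tip_dist n 3 t = 1 \<and> tip_dist n (m + 2) t + m + 2 = n \<or>
     t = 2 \<and> tip_dist n 1 t = 0 \<and> tip_dist n 3 t = 0 \<and> tip_dist n (m + 2) t + 1 = m \<or>
     t = 3 \<and> tip_dist n 1 t = 1 \<and> tip_dist n 3 t = 0 \<and> tip_dist n (m + 2) t + 2 = m \<or>
     4 \<le> t \<and> t \<le> m + 1 \<and>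
       tip_dist n 1 t + 2 = t \<and> tip_dist n 3 t + 4 = t \<and> tip_dist n (m + 2) t + t = m + 1 \<or>
     t = m + 2 \<and>
       tip_dist n 1 t + m + 2 = n \<and> tip_dist n 3 t + 2 = m \<and> tip_dist n (m + 2) t = 0 \<or>
     t = m + 3 \<and>
       tip_dist n 1 t + m + 3 = n \<and> tip_dist n 3 t + 1 = m \<and> tip_dist n (m + 2) t = 0 \<or>
     m + 4 \<le> t \<and> t \<le> n \<and>
       tip_dist n 1 t + t = n \<and> tip_dist n 3 t + t = n + 2 \<and> tip_dist n (m + 2) t + m + 3 = t"
proof -
  have "t = 1 \<or> t = 2 \<or> t = 3 \<or> 4 \<le> t \<and> t \<le> m + 1 \<or> t = m + 2 \<or> t = m + 3 \<or> m + 4 \<le> t \<and> t \<le> n"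
    using assms by auto
  then show ?thesis
    using m_bounds assms unfolding tip_dist_def arc_dist_landmarks[OF assms]
    by (elim disjE conjE; auto)
qed

context
  fixes t u :: nat
  assumes t: "t \<in> {1..n}" and u: "u \<in> {1..n}"
begin

lemma nxt_ivl: "nxt n t \<in> {1..n}" "nxt n u \<in> {1..n}"
  using t u nxt_in by simp_all

lemmas t_cases = arc_dist_cases[OF t] rung_dist_cases[OF t] tip_dist_cases[OF nxt_ivl(1)]
lemmas u_cases = arc_dist_cases[OF u] rung_dist_cases[OF u] tip_dist_cases[OF nxt_ivl(2)]

text \<open>In this and the following nine lemmas, one for each pair of layers, every combination of
  zones yields a linear system that forces equal indices or, for different layers, is
  inconsistent.\<close>

lemma landmark_code_P_P: "landmark_code n m (P t) = landmark_code n m (P u) \<Longrightarrow> t = u"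
  using m_bounds t_cases(1) u_cases(1) unfolding landmark_code_def P_dist.simps prod.inject
  by (elim disjE conjE; linarith)

lemma landmark_code_P_Q: "landmark_code n m (P t) = landmark_code n m (Q u) \<Longrightarrow> False"
  using m_bounds t_cases(1) u_cases(1) unfolding landmark_code_def P_dist.simps prod.inject
  by (elim disjE conjE; linarith)

lemma landmark_code_P_R: "landmark_code n m (P t) = landmark_code n m (R u) \<Longrightarrow> False"
  using m_bounds t_cases(1) u_cases(2) unfolding landmark_code_def P_dist.simps prod.inject
  by (elim disjE conjE; linarith)

lemma landmark_code_P_S: "landmark_code n m (P t) = landmark_code n m (S u) \<Longrightarrow> False"
  using m_bounds t_cases(1) u_cases(3) unfolding landmark_code_def P_dist.simps prod.inject
  by (elim disjE conjE; linarith)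

lemma landmark_code_Q_Q: "landmark_code n m (Q t) = landmark_code n m (Q u) \<Longrightarrow> t = u"
  using m_bounds t_cases(1) u_cases(1) unfolding landmark_code_def P_dist.simps prod.inject
  by (elim disjE conjE; linarith)

lemma landmark_code_Q_R: "landmark_code n m (Q t) = landmark_code n m (R u) \<Longrightarrow> False"
  using m_bounds t_cases(1) u_cases(2) unfolding landmark_code_def P_dist.simps prod.inject
  by (elim disjE conjE; linarith)

lemma landmark_code_Q_S: "landmark_code n m (Q t) = landmark_code n m (S u) \<Longrightarrow> False"
  using m_bounds t_cases(1) u_cases(3) unfolding landmark_code_def P_dist.simps prod.inject
  by (elim disjE conjE; linarith)

lemma landmark_code_R_R: "landmark_code n m (R t) = landmark_code n m (R u) \<Longrightarrow> t = u"
  using m_bounds t_cases(2) u_cases(2) unfolding landmark_code_def P_dist.simps prod.inject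
  by (elim disjE conjE; linarith)

lemma landmark_code_R_S: "landmark_code n m (R t) = landmark_code n m (S u) \<Longrightarrow> False"
  using m_bounds t_cases(2) u_cases(3) unfolding landmark_code_def P_dist.simps prod.inject
  by (elim disjE conjE; linarith)

lemma landmark_code_S_S: "landmark_code n m (S t) = landmark_code n m (S u) \<Longrightarrow> t = u"
  using m_bounds t_cases(3) u_cases(3) unfolding landmark_code_def P_dist.simps prod.inject
  \<comment> \<open>The zones describe the middle indices, so injectivity of \<open>nxt\<close> is
    needed to return to \<open>t\<close> and \<open>u\<close>.\<close>
  by (intro nxt_inj[OF _ t u]) (elim disjE conjE; linarith)

end

lemma inj_on_landmark_code: "inj_on (landmark_code n m) (pverts (Delta n))"
proof (rule inj_onI)
  fix u v
  assume "u \<in> pverts (Delta n)" "v \<in> pverts (Delta n)" "landmark_code n m u = landmark_code n m v"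
  then show "u = v"
    using landmark_code_P_P landmark_code_P_Q landmark_code_P_R landmark_code_P_S landmark_code_Q_Q
      landmark_code_Q_R landmark_code_Q_S landmark_code_R_R landmark_code_R_S landmark_code_S_S
    by (cases u; cases v) (metis in_pverts_Delta)+
qed

end

section \<open>The independent location number\<close>

theorem theorem6:
  fixes n :: nat
  assumes "6 \<le> n"
  shows "pair_graph.independent_location_number (Delta n) = 3"
proof -
  interpret connected_pair_graph "Delta n"
    using assms by (simp add: connected_pair_graph_Delta)
  define m where "m = n div 2"
  \<comment> \<open>These bounds place \<open>m + 2\<close> between 5 and \<open>n - 1\<close>, so
    \<open>P (m + 2)\<close> is adjacent to neither \<open>P 3\<close> nor
    \<open>P 1\<close>.\<close>
  have m: "3 \<le> m" "m + 3 \<le> n"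
    using assms by (auto simp: m_def)
  let ?Y = "{P 1, P 3, P (m + 2)}"
  have Y: "?Y \<subseteq> pverts (Delta n)"
    using m by auto
  have hops: "hops (P a) v = P_dist n a v" if "a \<in> {1..n}" "v \<in> pverts (Delta n)" for a v
    using that P_dist_arc P_dist_pred by (intro hops_eqI) auto
  have "u = v" if uv: "u \<in> pverts (Delta n)" "v \<in> pverts (Delta n)"
    and eq: "\<forall>y\<in>?Y. hops y u = hops y v" for u v
  proof -
    have "landmark_code n m u = landmark_code n m v"
      using eq uv m by (simp add: landmark_code_def hops)
    then show "u = v"
      using inj_on_landmark_code[OF assms m_def] uv by (simp add: inj_on_def)
  qed
  then have "resolving_set ?Y"
    unfolding resolving_set_iff_hops[OF Y] by blast
  moreover have "\<forall>u \<in> ?Y. \<forall>v \<in> ?Y. (u, v) \<notin> parcs (Delta n)"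
    using m by (auto simp: nxt_if)
  ultimately have "independent_resolving_set ?Y"
    by (simp add: independent_resolving_set_def)
  moreover have "card ?Y = 3"
    using m by simp
  moreover have "3 \<le> card Z" if "independent_resolving_set Z" for Z
    using that card_resolving_set_ge_3[OF assms] by (simp add: independent_resolving_set_def)
  ultimately show ?thesis
    unfolding independent_location_number_def by (intro Least_equality) blast+
qed

end
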